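(* Let $L>0$, $T>0$, $g\in L^2(\mathbb R_+)$, and suppose that the function $r\mapsto e^{\frac r{4T}}g(r)\big/\ln\left(1+\frac{4T}r\right)$ belongs to $L^\infty(\mathbb R_+)$. Let $$\gamma_n=-\frac\pi{2^{2n+1}n!}\int_0^\infty r^ng(r)\,dr,\quad n=0,1,2,\dots.$$ If for each $N\in\mathbb N$ there exists $u_N\in L^\infty(0,T)$ with $\|u_N\|_{L^\infty(0,T)}\le L$ such that $$\int_0^T\xi^nu_N(T-\xi)\,d\xi=\gamma_n,\quad n=0,1,\dots,N,$$ then $g\in\overline{\mathbf R_T^L}$, where the closure is taken in $L^2(\mathbb R_+)$.
   Context: $\mathbb R_+=(0,+\infty)$. $\mathbf R_T^L$ is the set of all functions $Y\in L^2(\mathbb R_+)$ for which there is $u\in L^\infty(0,T)$ with $\|u\|_{L^\infty(0,T)}\le L$ such that $$Y(r)=-\frac1\pi\int_0^T\frac1{2\xi}e^{-\frac r{4\xi}}u(T-\xi)\,d\xi,\quad r\in\mathbb R_+.$$ *)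

theory Defs
  imports "HOL-Analysis.Analysis" "HOL-Probability.Essential_Supremum"
begin

text \<open>
  Elements of the Lebesgue spaces are represented by functions rather than by classes modulo
  equality almost everywhere; all notions below are invariant under changes on null sets.
\<close>

definition L2_space :: "'a measure \<Rightarrow> ('a \<Rightarrow> real) set" where
  "L2_space M = {f \<in> borel_measurable M. integrable M (\<lambda>x. (f x)\<^sup>2)}"

definition L2_norm :: "'a measure \<Rightarrow> ('a \<Rightarrow> real) \<Rightarrow> real" where
  "L2_norm M f = sqrt (\<integral>x. (f x)\<^sup>2 \<partial>M)"

definition L2_closure :: "'a measure \<Rightarrow> ('a \<Rightarrow> real) set \<Rightarrow> ('a \<Rightarrow> real) set" where
  "L2_closure M A =
     {f \<in> L2_space M. \<forall>\<epsilon>>0. \<exists>h \<in> A \<inter> L2_space M. L2_norm M (\<lambda>x. f x - h x) < \<epsilon>}"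

definition Linf_norm :: "'a measure \<Rightarrow> ('a \<Rightarrow> real) \<Rightarrow> ereal" where
  "Linf_norm M f = esssup M (\<lambda>x. ereal \<bar>f x\<bar>)"

definition Linf_space :: "'a measure \<Rightarrow> ('a \<Rightarrow> real) set" where
  "Linf_space M = {f \<in> borel_measurable M. Linf_norm M f < \<infinity>}"

abbreviation halfline :: "real measure" where
  "halfline \<equiv> lebesgue_on {0<..}"

abbreviation time_interval :: "real \<Rightarrow> real measure" where
  "time_interval T \<equiv> lebesgue_on {0<..<T}"

definition reachable_set :: "real \<Rightarrow> real \<Rightarrow> (real \<Rightarrow> real) set" where
  "reachable_set T L =
     {Y \<in> L2_space halfline.
        \<exists>u \<in> Linf_space (time_interval T). Linf_norm (time_interval T) u \<le> ereal L \<and>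
          (AE r in halfline.
             Y r = - (1 / pi) *
               (\<integral>\<xi>. 1 / (2 * \<xi>) * exp (- r / (4 * \<xi>)) * u (T - \<xi>) \<partial>time_interval T))}"

definition moment_coeff :: "(real \<Rightarrow> real) \<Rightarrow> nat \<Rightarrow> real" where
  "moment_coeff g n =
     - (pi / (2 ^ (2 * n + 1) * fact n)) * (\<integral>r. r ^ n * g r \<partial>halfline)"

end

theory Submission
  imports Defs "HOL-Probability.Distributions"
begin

text \<open>
  Let \<open>Y\<^sub>N\<close> be the response to the control \<open>u\<^sub>N\<close>. By Fubini the moments of \<open>Y\<^sub>N\<close> up to order \<open>N\<close> are those
  of \<open>g\<close>. Both \<open>g\<close> and all \<open>Y\<^sub>N\<close> are dominated by a multiple of \<open>r powr (-1/4) * exp (- r / (8 T))\<close>; for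
  weights with exponential decay the polynomials are dense, so \<open>g - Y\<^sub>N\<close> tends weakly to zero in
  \<open>L\<^sup>2\<close>. The reachable set is convex, hence its weak sequential limits lie in its norm closure.
\<close>

subsection \<open>Weak limits and norm closure in \<open>L\<^sup>2\<close>\<close>

text \<open>On the half line moments do not determine a function in general; exponential decay
  removes this obstacle, so the common majorant is the crux. The hypothesis on \<open>g\<close>
  mirrors the true size of a response: the integral of
  \<open>1 / (2 * \<xi>) * exp (- r / (4 * \<xi>))\<close> over \<open>(0, T)\<close> is half the
  exponential integral \<open>E1 (r / (4 * T))\<close>, and
  \<open>E1 x \<le> exp (- x) * ln (1 + 1 / x)\<close>. The weight used here is coarser. It replaces
  the logarithm by a small negative power, which is still square integrable at 0, and gives up half
  of the exponential rate. The limit is taken among responses and not among controls, so convexity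
  is what carries \<open>g\<close> into the closure.\<close>

lemma L2_space_mult_integrable:
  assumes "f \<in> L2_space M" "g \<in> L2_space M"
  shows "integrable M (\<lambda>x. f x * g x)"
proof (rule Bochner_Integration.integrable_bound)
  show "integrable M (\<lambda>x. (f x)\<^sup>2 + (g x)\<^sup>2)"
    using assms by (auto simp: L2_space_def)
  show "(\<lambda>x. f x * g x) \<in> borel_measurable M"
    using assms by (auto simp: L2_space_def)
  have "\<bar>a * b\<bar> \<le> a\<^sup>2 + b\<^sup>2" for a b :: real
  proof -
    have "2 * \<bar>a * b\<bar> \<le> a\<^sup>2 + b\<^sup>2"
      using sum_squares_bound[of "\<bar>a\<bar>" "\<bar>b\<bar>"] by (simp add: abs_mult mult.assoc)
    then show ?thesis using abs_ge_zero[of "a * b"] by linarith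
  qed
  then show "AE x in M. norm (f x * g x) \<le> norm ((f x)\<^sup>2 + (g x)\<^sup>2)"
    by auto
qed

lemma L2_space_lincomb:
  assumes "f \<in> L2_space M" "g \<in> L2_space M"
  shows "(\<lambda>x. a * f x + b * g x) \<in> L2_space M"
proof -
  have "integrable M (\<lambda>x. a\<^sup>2 * (f x)\<^sup>2 + 2 * a * b * (f x * g x) + b\<^sup>2 * (g x)\<^sup>2)"
    using assms L2_space_mult_integrable[OF assms] by (auto simp: L2_space_def)
  then have "integrable M (\<lambda>x. (a * f x + b * g x)\<^sup>2)"
    by (simp add: power2_eq_square algebra_simps)
  then show ?thesis
    using assms by (auto simp: L2_space_def)
qed

lemma L2_space_diff:
  assumes "f \<in> L2_space M" "g \<in> L2_space M"
  shows "(\<lambda>x. f x - g x) \<in> L2_space M"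
  using L2_space_lincomb[OF assms, of 1 "-1"] by simp

lemma L2_space_dominated:
  fixes f :: "'a \<Rightarrow> real"
  assumes "f \<in> borel_measurable M" "g \<in> L2_space M" "AE x in M. \<bar>f x\<bar> \<le> g x"
  shows "f \<in> L2_space M"
proof -
  have "integrable M (\<lambda>x. (f x)\<^sup>2)"
  proof (rule Bochner_Integration.integrable_bound)
    show "integrable M (\<lambda>x. (g x)\<^sup>2)"
      using assms by (auto simp: L2_space_def)
    show "AE x in M. norm ((f x)\<^sup>2) \<le> norm ((g x)\<^sup>2)"
      using assms(3) by eventually_elim (auto intro!: abs_le_square_iff[THEN iffD1])
  qed (use assms in auto)
  then show ?thesis using assms by (auto simp: L2_space_def)
qed

text \<open>
  A Mazur-type lemma that avoids completeness of \<open>L\<^sup>2\<close>: with \<open>d\<close> the infimum of \<open>\<parallel>g - Y\<parallel>\<^sup>2\<close> over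
  \<open>A\<close>, expanding \<open>d \<le> \<parallel>(1 - t) (g - Y) + t (g - Y\<^sub>n)\<parallel>\<^sup>2\<close> and letting first \<open>n \<rightarrow> \<infinity>\<close> and then \<open>Y\<close> vary
  yields \<open>d \<le> (1 - t)\<^sup>2 d + t\<^sup>2 B\<close> for all \<open>t\<close>, hence \<open>d = 0\<close>.
\<close>
lemma L2_closure_of_weak_limit:
  fixes g :: "'a \<Rightarrow> real"
  assumes A: "A \<subseteq> L2_space M" and g: "g \<in> L2_space M"
    and convex: "\<And>X Y t. X \<in> A \<Longrightarrow> Y \<in> A \<Longrightarrow> 0 \<le> t \<Longrightarrow> t \<le> 1 \<Longrightarrow>
                   (\<lambda>x. (1 - t) * X x + t * Y x) \<in> A"
    and Y: "\<And>n. Y n \<in> A"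
    and bdd: "\<And>n. (\<integral>x. (g x - Y n x)\<^sup>2 \<partial>M) \<le> B"
    and weak: "\<And>v. v \<in> L2_space M \<Longrightarrow> (\<lambda>n. \<integral>x. v x * (g x - Y n x) \<partial>M) \<longlonglongrightarrow> 0"
  shows "g \<in> L2_closure M A"
proof -
  define q where "q X = (\<integral>x. (g x - X x)\<^sup>2 \<partial>M)" for X
  define d where "d = Inf (q ` A)"
  have q_nonneg: "0 \<le> q X" for X
    by (simp add: q_def)
  have bdd_q: "bdd_below (q ` A)"
    by (rule bdd_belowI[of _ 0]) (auto simp: q_nonneg)
  have d_le: "d \<le> q X" if "X \<in> A" for X
    unfolding d_def using that by (intro cInf_lower bdd_q) auto
  have "A \<noteq> {}" using Y by auto
  then have d_nonneg: "0 \<le> d"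
    unfolding d_def by (intro cInf_greatest) (auto simp: q_nonneg)
  have step: "d \<le> (1 - t)\<^sup>2 * q X + t\<^sup>2 * B" if X: "X \<in> A" and t: "0 \<le> t" "t \<le> 1" for X t
  proof -
    define v where "v x = g x - X x" for x
    have v: "v \<in> L2_space M"
      using L2_space_diff[OF g, of X] X A by (auto simp: v_def[abs_def])
    have "d \<le> (1 - t)\<^sup>2 * q X + 2 * t * (1 - t) * (\<integral>x. v x * (g x - Y n x) \<partial>M) + t\<^sup>2 * B" for n
    proof -
      have w: "(\<lambda>x. g x - Y n x) \<in> L2_space M"
        using L2_space_diff[OF g, of "Y n"] Y[of n] A by auto
      have "d \<le> q (\<lambda>x. (1 - t) * X x + t * Y n x)"
        by (intro d_le convex X Y t)
      also have "\<dots> = (\<integral>x. (1 - t)\<^sup>2 * (v x)\<^sup>2 + 2 * t * (1 - t) * (v x * (g x - Y n x))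
                        + t\<^sup>2 * (g x - Y n x)\<^sup>2 \<partial>M)"
        unfolding q_def v_def
        by (intro Bochner_Integration.integral_cong refl) (simp add: power2_eq_square algebra_simps)
      also have "\<dots> = (1 - t)\<^sup>2 * q X + 2 * t * (1 - t) * (\<integral>x. v x * (g x - Y n x) \<partial>M) + t\<^sup>2 * q (Y n)"
        using v w L2_space_mult_integrable[OF v w] by (simp add: q_def v_def L2_space_def)
      also have "t\<^sup>2 * q (Y n) \<le> t\<^sup>2 * B"
        using bdd[of n] by (intro mult_left_mono) (auto simp: q_def)
      finally show ?thesis by simp
    qed
    moreover have "(\<lambda>n. (1 - t)\<^sup>2 * q X + 2 * t * (1 - t) * (\<integral>x. v x * (g x - Y n x) \<partial>M) + t\<^sup>2 * B)
        \<longlonglongrightarrow> (1 - t)\<^sup>2 * q X + 2 * t * (1 - t) * 0 + t\<^sup>2 * B"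
      by (intro tendsto_intros weak v)
    ultimately show ?thesis
      by (intro LIMSEQ_le_const[of "\<lambda>n. (1 - t)\<^sup>2 * q X + 2 * t * (1 - t) * (\<integral>x. v x * (g x - Y n x) \<partial>M) + t\<^sup>2 * B"])
        auto
  qed
  have d_le': "d \<le> t * B" if t: "0 < t" "t \<le> 1" for t
  proof (cases "t = 1")
    case True
    then show ?thesis using step[OF Y[of 0], of 1] by simp
  next
    case False
    with t have t1: "0 < (1 - t)\<^sup>2" by simp
    \<comment> \<open>Solving \<open>step\<close> for \<open>q X\<close> yields a lower bound valid
      for every \<open>X\<close> in \<open>A\<close>, hence for the infimum. The division is why
      \<open>t = 1\<close> is treated separately.\<close>
    have "(d - t\<^sup>2 * B) / (1 - t)\<^sup>2 \<le> d"
      unfolding d_def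
    proof (intro cInf_greatest)
      fix y assume "y \<in> q ` A"
      then show "(Inf (q ` A) - t\<^sup>2 * B) / (1 - t)\<^sup>2 \<le> y"
        using step[of _ t] t t1 by (auto simp: d_def field_simps)
    qed (use \<open>A \<noteq> {}\<close> in auto)
    then have "d - t\<^sup>2 * B \<le> d * (1 - t)\<^sup>2"
      using t1 by (simp add: field_simps)
    then have "t * (d * (2 - t)) \<le> t * (t * B)"
      by (simp add: power2_eq_square algebra_simps)
    then have "d * (2 - t) \<le> t * B"
      using t by simp
    moreover have "d * 1 \<le> d * (2 - t)"
      using t d_nonneg by (intro mult_left_mono) auto
    ultimately show ?thesis by simp
  qed
  have "d \<le> 0"
  proof (rule field_le_epsilon)
    fix e :: real assume e: "0 < e"
    \<comment> \<open>The \<open>+ 1\<close> keeps the denominator positive even when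
      \<open>B = 0\<close>.\<close>
    define t where "t = min 1 (e / (\<bar>B\<bar> + 1))"
    have t: "0 < t" "t \<le> 1" using e by (auto simp: t_def)
    have "d \<le> t * B" by (rule d_le'[OF t])
    also have "\<dots> \<le> t * (\<bar>B\<bar> + 1)" using t by (intro mult_left_mono) auto
    also have "\<dots> \<le> e / (\<bar>B\<bar> + 1) * (\<bar>B\<bar> + 1)" by (intro mult_right_mono) (auto simp: t_def)
    also have "\<dots> = e" by (simp add: add_nonneg_pos field_simps)
    finally show "d \<le> 0 + e" by simp
  qed
  have "\<exists>h\<in>A \<inter> L2_space M. L2_norm M (\<lambda>x. g x - h x) < \<epsilon>" if "\<epsilon> > 0" for \<epsilon>
  proof -
    have "Inf (q ` A) < \<epsilon>\<^sup>2"
      using \<open>d \<le> 0\<close> that by (simp add: d_def order_le_less_trans)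
    then obtain X where X: "X \<in> A" "q X < \<epsilon>\<^sup>2"
      using cInf_lessD[of "q ` A"] \<open>A \<noteq> {}\<close> by auto
    then have "L2_norm M (\<lambda>x. g x - X x) < \<epsilon>"
      using that real_less_lsqrt[of \<epsilon> "q X"] by (simp add: L2_norm_def q_def)
    then show ?thesis using X A by auto
  qed
  then show ?thesis using g by (auto simp: L2_closure_def)
qed

subsection \<open>Vanishing moments and weak convergence\<close>

lemma power_le_fact_mult_exp:
  fixes x :: real
  assumes "0 \<le> x"
  shows "x ^ n \<le> fact n * exp x"
proof -
  have "x ^ n /\<^sub>R fact n = (\<Sum>k\<in>{n}. x ^ k /\<^sub>R fact k)" by simp
  also have "\<dots> \<le> exp x"
    unfolding exp_def
    by (intro sum_le_suminf summable_exp_generic) (use assms in auto)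
  finally show ?thesis by (simp add: field_simps)
qed

text \<open>
  A sequence dominated by a weight with exponential decay whose moments tend to zero tends weakly
  to zero. The test functions \<open>v\<close> for which this holds form a vector space closed under dominated
  limits; it contains the polynomials, hence (by Taylor expansion) the functions
  \<open>exp (- k a x) x\<^sup>n\<close>, hence (by Weierstrass) the continuous functions of \<open>exp (- a x)\<close>, hence the
  indicators of half lines, of Borel sets, and finally all admissible functions.
\<close>
locale vanishing_moments =
  fixes M :: "real measure" and h :: "nat \<Rightarrow> real \<Rightarrow> real" and \<phi> :: "real \<Rightarrow> real" and a :: real
  assumes id_measurable [measurable]: "(\<lambda>x. x) \<in> borel_measurable M"
    and nonneg: "AE x in M. 0 \<le> x"
    and h_measurable [measurable]: "\<And>N. h N \<in> borel_measurable M"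
    and \<phi>_measurable [measurable]: "\<phi> \<in> borel_measurable M"
    and h_bound: "\<And>N. AE x in M. \<bar>h N x\<bar> \<le> \<phi> x"
    and a_pos: "0 < a"
    and exp_integrable: "integrable M (\<lambda>x. exp (2 * a * x) * \<phi> x)"
    and moments: "\<And>n. (\<lambda>N. \<integral>x. x ^ n * h N x \<partial>M) \<longlonglongrightarrow> 0"
begin

definition weakly_null :: "(real \<Rightarrow> real) \<Rightarrow> bool" where
  "weakly_null v \<longleftrightarrow> v \<in> borel_measurable borel \<and> integrable M (\<lambda>x. v x * \<phi> x) \<and>
     (\<lambda>N. \<integral>x. v x * h N x \<partial>M) \<longlonglongrightarrow> 0"

lemma borel_measurable_lift: "v \<in> borel_measurable borel \<Longrightarrow> v \<in> borel_measurable M"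
  using measurable_compose[OF id_measurable] by simp

lemma \<phi>_nonneg: "AE x in M. 0 \<le> \<phi> x"
  using h_bound[of 0] by eventually_elim auto

lemma integrable_mult_h:
  assumes "v \<in> borel_measurable M" "integrable M (\<lambda>x. v x * \<phi> x)"
  shows "integrable M (\<lambda>x. v x * h N x)"
proof (rule Bochner_Integration.integrable_bound[OF assms(2)])
  show "AE x in M. norm (v x * h N x) \<le> norm (v x * \<phi> x)"
    using h_bound[of N] \<phi>_nonneg by eventually_elim (auto simp: abs_mult intro!: mult_left_mono)
qed (use assms(1) in measurable)

lemma integrable_mult_\<phi>_bound:
  assumes "v \<in> borel_measurable M" "integrable M (\<lambda>x. w x * \<phi> x)" "AE x in M. \<bar>v x\<bar> \<le> w x"
  shows "integrable M (\<lambda>x. v x * \<phi> x)"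
proof (rule Bochner_Integration.integrable_bound[OF assms(2)])
  show "AE x in M. norm (v x * \<phi> x) \<le> norm (w x * \<phi> x)"
    using assms(3) \<phi>_nonneg by eventually_elim (auto simp: abs_mult intro!: mult_right_mono)
qed (use assms(1) in measurable)

lemma weakly_null_lincomb:
  assumes "weakly_null v" "weakly_null w"
  shows "weakly_null (\<lambda>x. c * v x + d * w x)"
proof -
  have v: "v \<in> borel_measurable borel" "integrable M (\<lambda>x. v x * \<phi> x)"
      "(\<lambda>N. \<integral>x. v x * h N x \<partial>M) \<longlonglongrightarrow> 0"
    and w: "w \<in> borel_measurable borel" "integrable M (\<lambda>x. w x * \<phi> x)"
      "(\<lambda>N. \<integral>x. w x * h N x \<partial>M) \<longlonglongrightarrow> 0"
    using assms by (auto simp: weakly_null_def)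
  have "integrable M (\<lambda>x. c * (v x * \<phi> x) + d * (w x * \<phi> x))"
    using v w by auto
  moreover have "(\<lambda>N. c * (\<integral>x. v x * h N x \<partial>M) + d * (\<integral>x. w x * h N x \<partial>M)) \<longlonglongrightarrow> c * 0 + d * 0"
    by (intro tendsto_intros v w)
  moreover have "c * (\<integral>x. v x * h N x \<partial>M) + d * (\<integral>x. w x * h N x \<partial>M)
      = (\<integral>x. (c * v x + d * w x) * h N x \<partial>M)" for N
    using integrable_mult_h[OF borel_measurable_lift, of v N] integrable_mult_h[OF borel_measurable_lift, of w N] v w
    by (simp add: algebra_simps)
  ultimately show ?thesis
    using v w by (simp add: weakly_null_def algebra_simps)
qed

lemma weakly_null_zero: "weakly_null (\<lambda>x. 0)"
  by (simp add: weakly_null_def)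

lemma weakly_null_sum:
  assumes "finite I" "\<And>i. i \<in> I \<Longrightarrow> weakly_null (v i)"
  shows "weakly_null (\<lambda>x. \<Sum>i\<in>I. c i * v i x)"
  using assms
proof (induction I rule: finite_induct)
  case (insert i I)
  then show ?case
    using weakly_null_lincomb[of "v i" "\<lambda>x. \<Sum>i\<in>I. c i * v i x" "c i" 1] by simp
qed (simp add: weakly_null_zero)

text \<open>Since every \<open>h N\<close> is dominated by \<open>\<phi>\<close>, replacing
  \<open>v\<close> by \<open>u k\<close> changes the integrals by at most the
  \<open>\<phi>\<close>-weighted \<open>L1\<close> distance of \<open>u k\<close> and
  \<open>v\<close>, uniformly in \<open>N\<close>. Hence \<open>k\<close> can be fixed first and
  \<open>N\<close> sent to infinity afterwards.\<close>

lemma weakly_null_limit: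
  assumes v [measurable]: "v \<in> borel_measurable borel"
    and u: "\<And>k. weakly_null (u k)"
    and lim: "AE x in M. (\<lambda>k. u k x) \<longlonglongrightarrow> v x"
    and bound: "\<And>k. AE x in M. \<bar>u k x\<bar> \<le> w x"
    and w: "integrable M (\<lambda>x. w x * \<phi> x)"
  shows "weakly_null v"
proof -
  have u_meas [measurable]: "u k \<in> borel_measurable M" for k
    using u[of k] by (auto simp: weakly_null_def intro: borel_measurable_lift)
  have v_meas [measurable]: "v \<in> borel_measurable M"
    by (rule borel_measurable_lift[OF v])
  have "AE x in M. \<forall>k. \<bar>u k x\<bar> \<le> w x"
    using bound by (simp add: AE_all_countable)
  then have v_bound: "AE x in M. \<bar>v x\<bar> \<le> w x"
    using lim
  proof eventually_elim
    case (elim x)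
    have "(\<lambda>k. \<bar>u k x\<bar>) \<longlonglongrightarrow> \<bar>v x\<bar>" using elim by (intro tendsto_intros)
    then show ?case using elim(1) by (intro LIMSEQ_le_const2) auto
  qed
  have v_int: "integrable M (\<lambda>x. v x * \<phi> x)"
    by (rule integrable_mult_\<phi>_bound[OF v_meas w v_bound])
  have u_int: "integrable M (\<lambda>x. u k x * \<phi> x)" for k
    using u[of k] by (simp add: weakly_null_def)
  have dist: "(\<lambda>k. \<integral>x. \<bar>u k x - v x\<bar> * \<phi> x \<partial>M) \<longlonglongrightarrow> (\<integral>x. 0 \<partial>M)"
  proof (rule integral_dominated_convergence)
    show "AE x in M. (\<lambda>k. \<bar>u k x - v x\<bar> * \<phi> x) \<longlonglongrightarrow> 0"
      using lim
    proof eventually_elim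
      case (elim x)
      have "(\<lambda>k. \<bar>u k x - v x\<bar> * \<phi> x) \<longlonglongrightarrow> \<bar>v x - v x\<bar> * \<phi> x"
        by (intro tendsto_intros elim)
      then show ?case by simp
    qed
    show "AE x in M. norm (\<bar>u k x - v x\<bar> * \<phi> x) \<le> 2 * (w x * \<phi> x)" for k
      using bound[of k] v_bound \<phi>_nonneg
    proof eventually_elim
      case (elim x)
      have "\<bar>u k x - v x\<bar> * \<phi> x \<le> (2 * w x) * \<phi> x"
        using elim by (intro mult_right_mono) auto
      then show ?case using elim by (simp add: abs_mult)
    qed
    show "integrable M (\<lambda>x. 2 * (w x * \<phi> x))" using w by simp
  qed measurable
  have "(\<lambda>N. \<integral>x. v x * h N x \<partial>M) \<longlonglongrightarrow> 0"
  proof (rule LIMSEQ_I)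
    fix e :: real assume e: "0 < e"
    obtain k where k: "(\<integral>x. \<bar>u k x - v x\<bar> * \<phi> x \<partial>M) < e / 2"
    proof -
      have "\<forall>\<^sub>F k in sequentially. (\<integral>x. \<bar>u k x - v x\<bar> * \<phi> x \<partial>M) < e / 2"
        using order_tendstoD(2)[OF dist, of "e / 2"] e by simp
      then show ?thesis using that by (auto simp: eventually_sequentially)
    qed
    have "(\<lambda>N. \<integral>x. u k x * h N x \<partial>M) \<longlonglongrightarrow> 0"
      using u[of k] by (simp add: weakly_null_def)
    from LIMSEQ_D[OF this, of "e / 2"] e
    obtain N0 where N0: "\<And>N. N \<ge> N0 \<Longrightarrow> \<bar>\<integral>x. u k x * h N x \<partial>M\<bar> < e / 2" by auto
    have "\<bar>\<integral>x. v x * h N x \<partial>M\<bar> < e" if "N \<ge> N0" for N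
    proof -
      have i1: "integrable M (\<lambda>x. u k x * h N x)" and i2: "integrable M (\<lambda>x. v x * h N x)"
        by (intro integrable_mult_h u_meas u_int v_meas v_int)+
      have i3: "integrable M (\<lambda>x. \<bar>u k x - v x\<bar> * \<phi> x)"
      proof (rule Bochner_Integration.integrable_bound)
        show "integrable M (\<lambda>x. u k x * \<phi> x - v x * \<phi> x)"
          using u_int v_int by auto
      qed (auto simp: abs_mult simp flip: left_diff_distrib)
      have "\<bar>(\<integral>x. u k x * h N x \<partial>M) - (\<integral>x. v x * h N x \<partial>M)\<bar> = \<bar>\<integral>x. u k x * h N x - v x * h N x \<partial>M\<bar>"
        using i1 i2 by simp
      also have "\<dots> \<le> (\<integral>x. \<bar>u k x * h N x - v x * h N x\<bar> \<partial>M)"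
        by (rule integral_abs_bound)
      also have "\<dots> \<le> (\<integral>x. \<bar>u k x - v x\<bar> * \<phi> x \<partial>M)"
      proof (rule integral_mono_AE)
        show "AE x in M. \<bar>u k x * h N x - v x * h N x\<bar> \<le> \<bar>u k x - v x\<bar> * \<phi> x"
          using h_bound[of N]
          by eventually_elim (auto simp: abs_mult simp flip: left_diff_distrib intro!: mult_left_mono)
      qed (use i1 i2 i3 in auto)
      finally show ?thesis using N0[OF that] k by linarith
    qed
    then show "\<exists>N0. \<forall>N\<ge>N0. norm ((\<integral>x. v x * h N x \<partial>M) - 0) < e" by auto
  qed
  then show ?thesis using v v_int by (simp add: weakly_null_def)
qed

text \<open>This explains the factor 2 in \<open>exp_integrable\<close>: one factor
  \<open>exp (a * x)\<close> absorbs the power of \<open>x\<close>, the other survives as a majorant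
  for Taylor polynomials.\<close>

lemma power_exp_integrable: "integrable M (\<lambda>x. (x ^ n * exp (a * x)) * \<phi> x)"
proof (rule integrable_mult_\<phi>_bound)
  show "integrable M (\<lambda>x. (fact n / a ^ n * exp (2 * a * x)) * \<phi> x)"
    using exp_integrable by (simp add: mult.assoc)
  show "AE x in M. \<bar>x ^ n * exp (a * x)\<bar> \<le> fact n / a ^ n * exp (2 * a * x)"
    using nonneg
  proof eventually_elim
    case (elim x)
    have "(a * x) ^ n * exp (a * x) \<le> fact n * exp (a * x) * exp (a * x)"
      using elim a_pos by (intro mult_right_mono power_le_fact_mult_exp) auto
    then show ?case
      using elim a_pos by (simp add: power_mult_distrib field_simps flip: exp_add)
  qed
qed measurable

text \<open>Expanding \<open>exp (- k * a * x)\<close> at once would need the majorant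
  \<open>exp (k * a * x)\<close>, which the weight cannot afford for large \<open>k\<close>. Each
  induction step expands just one factor \<open>exp (- a * x)\<close>, at the cost of one
  \<open>exp (a * x)\<close>, while the factors already gained are at most 1. The Taylor terms raise
  the power of \<open>x\<close>, so \<open>n\<close> must be arbitrary in the induction.\<close>

lemma weakly_null_exp_power: "weakly_null (\<lambda>x. exp (- (real k * a) * x) * x ^ n)"
proof (induction k arbitrary: n)
  case 0
  have "integrable M (\<lambda>x. x ^ n * \<phi> x)"
    by (rule integrable_mult_\<phi>_bound[OF _ power_exp_integrable[of n]])
      (use nonneg a_pos in \<open>auto simp: mult_le_cancel_left1 elim!: eventually_mono\<close>)
  then show ?case using moments[of n] by (simp add: weakly_null_def)
next
  case (Suc k)
  define u where "u J x = (\<Sum>j<J. ((- a) ^ j / fact j) * (exp (- (real k * a) * x) * x ^ (n + j)))" for J x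
  have u_eq: "u J x = exp (- (real k * a) * x) * x ^ n * (\<Sum>j<J. (- a * x) ^ j /\<^sub>R fact j)" for J x
    unfolding u_def sum_distrib_left
    by (intro sum.cong refl) (simp add: field_simps power_add flip: power_mult_distrib)
  show ?case
  proof (rule weakly_null_limit[where u = u, OF _ _ _ _ power_exp_integrable[of n]])
    show "weakly_null (u J)" for J
      unfolding u_def by (intro weakly_null_sum Suc.IH) auto
    have "(\<lambda>J. u J x) \<longlonglongrightarrow> exp (- (real k * a) * x) * x ^ n * exp (- a * x)" for x
      unfolding u_eq using exp_converges[of "- a * x"] by (intro tendsto_intros) (simp add: sums_def)
    moreover have "exp (- (real k * a) * x) * x ^ n * exp (- a * x) = exp (- (real (Suc k) * a) * x) * x ^ n" for x
      by (simp add: algebra_simps flip: exp_add)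
    ultimately show "AE x in M. (\<lambda>J. u J x) \<longlonglongrightarrow> exp (- (real (Suc k) * a) * x) * x ^ n"
      by (intro AE_I2) metis
    show "AE x in M. \<bar>u J x\<bar> \<le> x ^ n * exp (a * x)" for J
      using nonneg
    proof eventually_elim
      case (elim x)
      have "\<bar>\<Sum>j<J. (- a * x) ^ j /\<^sub>R fact j\<bar> \<le> (\<Sum>j<J. (a * x) ^ j /\<^sub>R fact j)"
        using elim a_pos
        by (intro order_trans[OF sum_abs] sum_mono) (auto simp: abs_mult power_abs)
      also have "\<dots> \<le> exp (a * x)"
        unfolding exp_def using elim a_pos
        by (intro sum_le_suminf summable_exp_generic) auto
      finally have *: "\<bar>\<Sum>j<J. (- a * x) ^ j /\<^sub>R fact j\<bar> \<le> exp (a * x)" .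
      have "exp (- (real k * a) * x) * x ^ n \<le> 1 * x ^ n"
        using elim a_pos by (intro mult_right_mono) auto
      then have "(exp (- (real k * a) * x) * x ^ n) * \<bar>\<Sum>j<J. (- a * x) ^ j /\<^sub>R fact j\<bar> \<le> x ^ n * exp (a * x)"
        using * elim by (intro mult_mono) auto
      then show ?case using elim by (simp add: u_eq abs_mult)
    qed
  qed measurable
qed

lemma integrable_\<phi>: "integrable M (\<lambda>x. c * \<phi> x)"
  using weakly_null_exp_power[of 0 0] by (simp add: weakly_null_def)

text \<open>The substitution \<open>y = exp (- a * x)\<close> compresses the half line into
  \<open>[0, 1]\<close>, where Weierstrass approximation is uniform. A polynomial in
  \<open>y\<close> is a combination of the exponentials
  \<open>exp (- (real i * a) * x)\<close>.\<close>

lemma weakly_null_continuous_exp: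
  fixes f :: "real \<Rightarrow> real"
  assumes f: "continuous_on UNIV f"
  shows "weakly_null (\<lambda>x. f (exp (- a * x)))"
proof -
  have "\<exists>p. real_polynomial_function p \<and> (\<forall>y\<in>{0..1}. \<bar>f y - p y\<bar> < 1 / real (Suc k))" for k
    by (rule Stone_Weierstrass_real_polynomial_function[of "{0..1::real}" f "1 / real (Suc k)"])
      (use continuous_on_subset[OF f] in auto)
  then obtain p where p: "\<And>k. real_polynomial_function (p k)"
      "\<And>k y. y \<in> {0..1} \<Longrightarrow> \<bar>f y - p k y\<bar> < 1 / real (Suc k)"
    by metis
  have unit: "exp (- a * x) \<in> {0..1}" if "0 \<le> x" for x
    using that a_pos by simp
  have "compact (f ` {0..1})"
    by (rule compact_continuous_image[OF continuous_on_subset[OF f]]) auto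
  then obtain B where "\<forall>y\<in>f ` {0..1}. norm y \<le> B"
    using compact_imp_bounded bounded_iff by metis
  then have B: "\<bar>f y\<bar> \<le> B" if "y \<in> {0..1}" for y
    using that by auto
  show ?thesis
  proof (rule weakly_null_limit[where u = "\<lambda>k x. p k (exp (- a * x))" and w = "\<lambda>_. B + 1"])
    have [measurable]: "f \<in> borel_measurable borel"
      using f by (rule borel_measurable_continuous_onI)
    show "(\<lambda>x. f (exp (- a * x))) \<in> borel_measurable borel" by measurable
    show "weakly_null (\<lambda>x. p k (exp (- a * x)))" for k
    proof -
      obtain c m where cm: "p k = (\<lambda>x. \<Sum>i\<le>m. c i * x ^ i)"
        using p(1)[of k] unfolding real_polynomial_function_iff_sum by blast
      have "weakly_null (\<lambda>x. \<Sum>i\<le>m. c i * (exp (- (real i * a) * x) * x ^ 0))"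
        by (intro weakly_null_sum weakly_null_exp_power) auto
      then show ?thesis
        unfolding cm by (simp add: mult.assoc flip: exp_of_nat_mult)
    qed
    show "AE x in M. (\<lambda>k. p k (exp (- a * x))) \<longlonglongrightarrow> f (exp (- a * x))"
      using nonneg
    proof eventually_elim
      case (elim x)
      have "(\<lambda>k. p k (exp (- a * x)) - f (exp (- a * x))) \<longlonglongrightarrow> 0"
      proof (rule Lim_null_comparison)
        show "\<forall>\<^sub>F k in sequentially. norm (p k (exp (- a * x)) - f (exp (- a * x))) \<le> 1 / real (Suc k)"
          using p(2)[OF unit[OF elim]] by (auto simp: abs_minus_commute less_imp_le)
        show "(\<lambda>k. 1 / real (Suc k)) \<longlonglongrightarrow> 0"
          using LIMSEQ_inverse_real_of_nat by (simp add: inverse_eq_divide)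
      qed
      then show ?case by (simp add: LIM_zero_iff)
    qed
    show "AE x in M. \<bar>p k (exp (- a * x))\<bar> \<le> B + 1" for k
      using nonneg
    proof eventually_elim
      case (elim x)
      have "1 / real (Suc k) \<le> 1" by simp
      then show ?case using p(2)[OF unit[OF elim], of k] B[OF unit[OF elim]] by linarith
    qed
    show "integrable M (\<lambda>x. (B + 1) * \<phi> x)" by (rule integrable_\<phi>)
  qed
qed

lemma weakly_null_indicator_atMost: "weakly_null (indicator {..c})"
proof (rule weakly_null_limit[where w = "\<lambda>_. 1"])
  \<comment> \<open>A ramp in \<open>y = exp (- a * x)\<close>: it is 1 for
    \<open>y \<ge> exp (- a * c)\<close>, that is for \<open>x \<le> c\<close>, and falls to 0 below
    this threshold with slope \<open>k\<close>.\<close>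
  define f where "f k y = max 0 (1 - real k * max 0 (exp (- a * c) - y))" for k y
  show "weakly_null (\<lambda>x. f k (exp (- a * x)))" for k
    by (rule weakly_null_continuous_exp) (auto simp: f_def intro!: continuous_intros)
  have "(\<lambda>k. f k (exp (- a * x))) \<longlonglongrightarrow> indicator {..c} x" for x
  proof (cases "x \<le> c")
    case True
    then have "exp (- a * c) \<le> exp (- a * x)" using a_pos by simp
    then show ?thesis using True by (simp add: f_def)
  next
    case False
    then have *: "exp (- a * x) < exp (- a * c)" using a_pos by simp
    define \<delta> where "\<delta> = exp (- a * c) - exp (- a * x)"
    have "\<delta> > 0" using * by (simp add: \<delta>_def)
    then obtain k0 where k0: "1 < real k0 * \<delta>"
      using reals_Archimedean3 by blast
    have "f k (exp (- a * x)) = 0" if "k \<ge> k0" for k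
    proof -
      have "real k0 * \<delta> \<le> real k * \<delta>"
        using that \<open>\<delta> > 0\<close> by (intro mult_right_mono) auto
      then have "1 \<le> real k * \<delta>" using k0 by linarith
      then have "1 - real k * max 0 \<delta> \<le> 0" using \<open>\<delta> > 0\<close> by (simp only: max.absorb2 less_imp_le)
      then show ?thesis unfolding f_def \<delta>_def[symmetric] by simp
    qed
    then have "\<forall>\<^sub>F k in sequentially. f k (exp (- a * x)) = 0"
      by (auto simp: eventually_sequentially)
    then show ?thesis using False by (simp add: tendsto_eventually)
  qed
  then show "AE x in M. (\<lambda>k. f k (exp (- a * x))) \<longlonglongrightarrow> indicator {..c} x" by simp
  show "AE x in M. \<bar>f k (exp (- a * x))\<bar> \<le> 1" for k
    by (simp add: f_def)
  show "integrable M (\<lambda>x. 1 * \<phi> x)" by (rule integrable_\<phi>)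
qed auto

text \<open>Dynkin's argument: half lines are closed under intersection and generate the Borel sets,
  so complements and disjoint unions remain. Disjointness turns the indicator of a finite union into
  a sum, and the countable union is a limit dominated by 1.\<close>

lemma weakly_null_indicator:
  assumes "A \<in> sets borel"
  shows "weakly_null (indicator A)"
proof -
  have sets: "sigma_sets UNIV (range (\<lambda>c::real. {..c})) = sets borel"
    by (subst borel_eq_atMost) simp
  have "Int_stable (range (\<lambda>c::real. {..c}))"
    by (auto simp: Int_stable_def)
  moreover have "range (\<lambda>c::real. {..c}) \<subseteq> Pow UNIV" by simp
  moreover have "A \<in> sigma_sets UNIV (range (\<lambda>c::real. {..c}))" using assms sets by simp
  ultimately show ?thesis
  proof (induction rule: sigma_sets_induct_disjoint)
    case (basic A)
    then show ?case using weakly_null_indicator_atMost by auto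
  next
    case empty
    then show ?case using weakly_null_zero by (simp add: indicator_def)
  next
    case (compl A)
    have "weakly_null (\<lambda>x. 1)"
      using weakly_null_exp_power[of 0 0] by simp
    from weakly_null_lincomb[OF this compl(2), of 1 "-1"]
    moreover have "(\<lambda>x. 1 * 1 + - 1 * indicator A x) = (indicator (UNIV - A) :: real \<Rightarrow> real)"
      by (auto simp: indicator_def)
    ultimately show ?case by simp
  next
    case (union A)
    show ?case
    proof (rule weakly_null_limit[where w = "\<lambda>_. 1" and u = "\<lambda>k x. \<Sum>i<k. 1 * indicator (A i) x"])
      show "indicator (\<Union>i. A i) \<in> borel_measurable (borel :: real measure)"
        using union(2) unfolding sets by (intro borel_measurable_indicator) auto
      show "weakly_null (\<lambda>x. \<Sum>i<k. 1 * indicator (A i) x)" for k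
        by (intro weakly_null_sum union) auto
      have eq: "(\<Sum>i<k. 1 * indicator (A i) x) = (indicator (\<Union>i<k. A i) x :: real)" for k x
        by (simp, rule indicator_UN_disjoint[symmetric])
          (use disjoint_family_on_mono[of "{..<k}" UNIV A, OF subset_UNIV union(1)] in auto)
      show "AE x in M. (\<lambda>k. \<Sum>i<k. 1 * indicator (A i) x) \<longlonglongrightarrow> (indicator (\<Union>i. A i) x :: real)"
        unfolding eq by (intro AE_I2 LIMSEQ_indicator_UN)
      show "AE x in M. \<bar>\<Sum>i<k. 1 * indicator (A i) x :: real\<bar> \<le> 1" for k
        unfolding eq by (simp add: indicator_def)
      show "integrable M (\<lambda>x. 1 * \<phi> x)" by (rule integrable_\<phi>)
    qed
  qed
qed

text \<open>Simple functions converge to \<open>v\<close> pointwise and stay below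
  \<open>2 * \<bar>v x\<bar>\<close>, so integrability of \<open>v x * \<phi> x\<close> suffices for
  the dominated limit. It holds for every \<open>v\<close> in \<open>L2\<close> once
  \<open>\<phi>\<close> lies in \<open>L2\<close>.\<close>

lemma weakly_null_borel:
  assumes v: "v \<in> borel_measurable borel" and int: "integrable M (\<lambda>x. v x * \<phi> x)"
  shows "weakly_null v"
proof -
  obtain s where s: "\<And>i. simple_function borel (s i)"
      "\<And>x. (\<lambda>i. s i x) \<longlonglongrightarrow> v x" "\<And>i x. \<bar>s i x\<bar> \<le> 2 * \<bar>v x\<bar>"
    using borel_measurable_implies_sequence_metric[OF v, of 0] by (auto simp: dist_real_def)
  show ?thesis
  proof (rule weakly_null_limit[OF v, where u = s and w = "\<lambda>x. 2 * \<bar>v x\<bar>"])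
    show "weakly_null (s i)" for i
    proof -
      have fin: "finite (range (s i))"
        using s(1)[of i] by (simp add: simple_function_def)
      have "weakly_null (\<lambda>x. \<Sum>y\<in>range (s i). y * indicator (s i -` {y}) x)"
        using s(1)[of i] fin
        by (intro weakly_null_sum weakly_null_indicator) (auto simp: simple_function_def)
      moreover have "(\<Sum>y\<in>range (s i). y * indicator (s i -` {y}) x) = s i x" for x
        using simple_function_indicator_representation_banach[OF s(1)[of i], of x, symmetric]
        by (simp add: mult.commute)
      ultimately show ?thesis by simp
    qed
    have "AE x in M. norm (v x * \<phi> x) = \<bar>v x\<bar> * \<phi> x"
      using \<phi>_nonneg by eventually_elim (simp add: abs_mult)
    then have "integrable M (\<lambda>x. \<bar>v x\<bar> * \<phi> x) \<longleftrightarrow> integrable M (\<lambda>x. norm (v x * \<phi> x))"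
      using borel_measurable_lift[OF v] by (intro integrable_cong_AE) auto
    then show "integrable M (\<lambda>x. 2 * \<bar>v x\<bar> * \<phi> x)"
      using int by (simp add: mult.assoc integrable_norm)
    show "AE x in M. (\<lambda>i. s i x) \<longlonglongrightarrow> v x" by (intro AE_I2 s(2))
    show "AE x in M. \<bar>s i x\<bar> \<le> 2 * \<bar>v x\<bar>" for i by (intro AE_I2 s(3))
  qed
qed

end

subsection \<open>The response operator\<close>

lemma sigma_finite_lebesgue_on:
  assumes "S \<in> sets lebesgue"
  shows "sigma_finite_measure (lebesgue_on S)"
proof (rule sigma_finite_measure_restrict_space[OF _ assms])
  show "sigma_finite_measure (lebesgue :: 'a measure)"
  proof
    obtain A :: "'a set set" where A: "countable A" "A \<subseteq> sets lborel" "\<Union>A = space lborel"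
        "\<forall>a\<in>A. emeasure lborel a \<noteq> \<infinity>"
      using lborel.sigma_finite_countable by blast
    then show "\<exists>A. countable A \<and> A \<subseteq> sets (lebesgue :: 'a measure) \<and> \<Union> A = space (lebesgue :: 'a measure)
        \<and> (\<forall>a\<in>A. emeasure (lebesgue :: 'a measure) a \<noteq> \<infinity>)"
      by (intro exI[of _ A]) (auto simp: subset_eq)
  qed
qed

lemma id_measurable_lebesgue_on: "(\<lambda>x. x) \<in> borel_measurable (lebesgue_on S)"
  using id_borel_measurable_lebesgue_on[of S] by (simp add: id_def)

lemma lebesgue_on_ae_space: "AE x in lebesgue_on S. x \<in> S"
  by (rule AE_I2) (simp add: space_restrict_space)

lemma integrable_lebesgue_on_subset:
  fixes f :: "'a::euclidean_space \<Rightarrow> real"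
  assumes "integrable (lebesgue_on S) f" "U \<subseteq> S" "S \<in> sets lebesgue" "U \<in> sets lebesgue"
  shows "integrable (lebesgue_on U) f"
  using set_integrable_subset[of lebesgue S f U] assms
  by (simp add: integrable_restrict_space set_integrable_def)

lemma finite_measure_time_interval: "finite_measure (time_interval T)"
  using finite_measure_lebesgue_on[OF lmeasurable_box[of 0 T]] by simp

section \<open>Gamma integrals and the dominating weight\<close>

lemma integrable_power_exp_halfline:
  assumes s: "s > 0" and c: "c > 0"
  shows "integrable halfline (\<lambda>r. r powr (s - 1) * exp (- c * r))"
proof -
  \<comment> \<open>The real integrand is the norm of the complex Gamma integrand at a real
    exponent.\<close>
  have "integrable halfline (\<lambda>t. complex_of_real t powr (of_real s - 1) / of_real (exp (c * t)))"
    using absolutely_integrable_Gamma_integral[of "of_real s" c] s c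
    by (simp add: integrable_restrict_space set_integrable_def)
  then have "integrable halfline (\<lambda>t. norm (complex_of_real t powr (of_real s - 1) / of_real (exp (c * t))))"
    by (rule integrable_norm)
  also have "?this \<longleftrightarrow> ?thesis"
    by (intro Bochner_Integration.integrable_cong refl)
      (auto simp: norm_divide norm_powr_real_powr exp_minus field_simps space_restrict_space)
  finally show ?thesis .
qed

lemma has_bochner_integral_power_exp_halfline:
  assumes l: "l > 0"
  shows "has_bochner_integral halfline (\<lambda>r. r ^ n * exp (- l * r)) (fact n / l ^ Suc n)"
proof (rule has_bochner_integral_nn_integral)
  show "(\<lambda>r. r ^ n * exp (- l * r)) \<in> borel_measurable halfline"
    using id_measurable_lebesgue_on[of "{0<..}"] by measurable
  show "AE r in halfline. 0 \<le> r ^ n * exp (- l * r)"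
    using lebesgue_on_ae_space by eventually_elim auto
  have "(\<integral>\<^sup>+r. ennreal (r ^ n * exp (- l * r)) \<partial>halfline)
      = (\<integral>\<^sup>+r. ennreal (r ^ n * exp (- l * r)) * indicator {0<..} r \<partial>lborel)"
    by (simp add: nn_integral_restrict_space nn_integral_completion)
  \<comment> \<open>Up to this factor the integrand is an Erlang density, whose zeroth moment is 1.
    The two integrands can differ only at \<open>r = 0\<close>.\<close>
  also have "\<dots> = (\<integral>\<^sup>+r. ennreal (fact n / l ^ Suc n) * ennreal (erlang_density n l r * r ^ 0) \<partial>lborel)"
  proof (rule nn_integral_cong_AE)
    have "AE r in lborel. r \<noteq> (0 :: real)" by (rule AE_lborel_singleton)
    then show "AE r in lborel. ennreal (r ^ n * exp (- l * r)) * indicator {0<..} r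
        = ennreal (fact n / l ^ Suc n) * ennreal (erlang_density n l r * r ^ 0)"
      by eventually_elim
        (use l in \<open>auto simp: erlang_density_def indicator_def field_simps simp flip: ennreal_mult'\<close>)
  qed
  also have "\<dots> = ennreal (fact n / l ^ Suc n)"
    using nn_integral_erlang_ith_moment[OF l, of n 0] by (subst nn_integral_cmult) auto
  finally show "(\<integral>\<^sup>+r. ennreal (r ^ n * exp (- l * r)) \<partial>halfline) = ennreal (fact n / l ^ Suc n)" .
qed (use l in auto)

text \<open>The square behaves like \<open>r powr (- 1 / 2)\<close> at 0 and is integrable there,
  while the kernel bound is left with \<open>\<xi> powr (- 3 / 4)\<close>, also integrable at 0. Any
  exponent strictly between \<open>- 1 / 2\<close> and 0 meets both demands. The rate is half of the
  \<open>1 / (4 * T)\<close> of the slowest kernel; in the kernel bound the other half pays for the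
  singular factor \<open>1 / \<xi>\<close>.\<close>

definition decay :: "real \<Rightarrow> real \<Rightarrow> real" where
  "decay T r = r powr (- 1 / 4) * exp (- r / (8 * T))"

lemma decay_nonneg: "0 \<le> decay T r"
  by (simp add: decay_def)

lemma decay_measurable: "decay T \<in> borel_measurable halfline"
  unfolding decay_def[abs_def] using id_measurable_lebesgue_on[of "{0<..}"] by measurable

lemma decay_L2_space:
  assumes "T > 0"
  shows "decay T \<in> L2_space halfline"
proof -
  have "integrable halfline (\<lambda>r. r powr (1 / 2 - 1) * exp (- (1 / (4 * T)) * r))"
    using assms by (intro integrable_power_exp_halfline) auto
  also have "(\<lambda>r. r powr (1 / 2 - 1) * exp (- (1 / (4 * T)) * r)) = (\<lambda>r. (decay T r)\<^sup>2)"
  proof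
    fix r :: real
    have "(r powr (- 1 / 4))\<^sup>2 = r powr (1 / 2 - 1)"
      by (simp add: power2_eq_square flip: powr_add)
    moreover have "(exp (- r / (8 * T)))\<^sup>2 = exp (- (1 / (4 * T)) * r)"
      using assms by (simp add: field_simps flip: exp_double)
    ultimately show "r powr (1 / 2 - 1) * exp (- (1 / (4 * T)) * r) = (decay T r)\<^sup>2"
      by (simp add: decay_def power_mult_distrib)
  qed
  finally show ?thesis
    using decay_measurable by (simp add: L2_space_def)
qed

lemma exp_decay_integrable:
  assumes "T > 0"
  shows "integrable halfline (\<lambda>r. exp (r / (16 * T)) * decay T r)"
proof -
  have "integrable halfline (\<lambda>r. r powr (3 / 4 - 1) * exp (- (1 / (16 * T)) * r))"
    using assms by (intro integrable_power_exp_halfline) auto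
  also have "(\<lambda>r. r powr (3 / 4 - 1) * exp (- (1 / (16 * T)) * r)) = (\<lambda>r. exp (r / (16 * T)) * decay T r)"
  proof
    fix r :: real
    have "exp (- (1 / (16 * T)) * r) = exp (r / (16 * T)) * exp (- r / (8 * T))"
      using assms by (simp add: field_simps flip: exp_add)
    then show "r powr (3 / 4 - 1) * exp (- (1 / (16 * T)) * r) = exp (r / (16 * T)) * decay T r"
      by (simp add: decay_def)
  qed
  finally show ?thesis .
qed

lemma power_mult_integrable:
  assumes T: "T > 0" and f: "f \<in> borel_measurable halfline"
    and bound: "AE r in halfline. \<bar>f r\<bar> \<le> K * decay T r"
  shows "integrable halfline (\<lambda>r. r ^ n * f r)"
proof (rule Bochner_Integration.integrable_bound)
  have "integrable halfline (\<lambda>r. r powr (real n + 3 / 4 - 1) * exp (- (1 / (8 * T)) * r))"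
    using T by (intro integrable_power_exp_halfline) auto
  also have "?this \<longleftrightarrow> integrable halfline (\<lambda>r. r ^ n * decay T r)"
  proof (intro Bochner_Integration.integrable_cong refl)
    fix r assume "r \<in> space halfline"
    then have r: "0 < r" by (simp add: space_restrict_space)
    have "r powr (real n + 3 / 4 - 1) = r powr (real n + - 1 / 4)" by simp
    also have "\<dots> = r ^ n * r powr (- 1 / 4)"
      using r by (simp only: powr_add powr_realpow)
    finally show "r powr (real n + 3 / 4 - 1) * exp (- (1 / (8 * T)) * r) = r ^ n * decay T r"
      by (simp add: decay_def)
  qed
  finally show "integrable halfline (\<lambda>r. K * (r ^ n * decay T r))" by simp
  note [measurable] = f id_measurable_lebesgue_on
  show "(\<lambda>r. r ^ n * f r) \<in> borel_measurable halfline"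
    by measurable
  show "AE r in halfline. norm (r ^ n * f r) \<le> norm (K * (r ^ n * decay T r))"
    using bound lebesgue_on_ae_space
  proof eventually_elim
    case (elim r)
    have "r ^ n * \<bar>f r\<bar> \<le> r ^ n * (K * decay T r)"
      using elim by (intro mult_left_mono) auto
    also have "\<dots> = K * (r ^ n * decay T r)" by (simp add: mult_ac)
    finally have "r ^ n * \<bar>f r\<bar> \<le> \<bar>K * (r ^ n * decay T r)\<bar>"
      by (rule order_trans[OF _ abs_ge_self])
    then show ?case using elim by (simp add: abs_mult)
  qed
qed

section \<open>Elementary inequalities behind the domination\<close>

lemma powr_le_exp:
  fixes s a :: real
  assumes "0 < s" "0 \<le> a" "a \<le> 1"
  shows "s powr a \<le> exp s"
proof -
  have "a * ln s \<le> a * s"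
    using ln_le_minus_one[OF assms(1)] assms by (intro mult_left_mono) auto
  also have "\<dots> \<le> s" using assms by (simp add: mult_left_le_one_le)
  finally show ?thesis using assms by (simp add: powr_def)
qed

text \<open>The exponential is the square of \<open>exp (- s)\<close> with
  \<open>s = r / (8 * \<xi>)\<close>. One factor gives the decay, because \<open>\<xi> < T\<close>;
  the other is at most \<open>s powr (- 1 / 4)\<close>, which trades a quarter power of the
  singularity in \<open>\<xi>\<close> for one in \<open>r\<close>.\<close>

lemma kernel_le_decay:
  assumes "0 < \<xi>" "\<xi> < T" "0 < r"
  shows "1 / (2 * \<xi>) * exp (- r / (4 * \<xi>)) \<le> \<xi> powr (1 / 4 - 1) * decay T r"
proof -
  define s where "s = r / (8 * \<xi>)"
  have s: "0 < s" using assms by (simp add: s_def)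
  have "exp (- s) \<le> exp (- r / (8 * T))"
    using assms by (simp add: s_def frac_le)
  moreover have "exp (- s) \<le> s powr (- 1 / 4)"
    using powr_le_exp[of s "1 / 4"] s by (simp add: exp_minus powr_minus le_imp_inverse_le)
  moreover have "s powr (- 1 / 4) \<le> 2 * \<xi> powr (1 / 4) * r powr (- 1 / 4)"
  proof -
    have "s powr (- 1 / 4) = r powr (- 1 / 4) * (8 powr (1 / 4) * \<xi> powr (1 / 4))"
      using assms by (simp add: s_def powr_divide powr_mult powr_minus field_simps)
    \<comment> \<open>Rounding 8 up to 16 makes the constant exactly 2, which cancels against
      \<open>1 / (2 * \<xi>)\<close>.\<close>
    also have "(8::real) powr (1 / 4) \<le> 16 powr (1 / 4)"
      by (intro powr_mono2) auto
    also have "(16::real) powr (1 / 4) = (2 powr 4) powr (1 / 4)"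
      by simp
    also have "\<dots> = 2" by (subst powr_powr) simp
    finally show ?thesis using assms by (simp add: mult_ac)
  qed
  ultimately have "exp (- s) * exp (- s) \<le> (2 * \<xi> powr (1 / 4) * r powr (- 1 / 4)) * exp (- r / (8 * T))"
    by (intro mult_mono) auto
  also have "exp (- s) * exp (- s) = exp (- r / (4 * \<xi>))"
    using assms by (simp add: s_def field_simps flip: exp_add)
  finally have "1 / (2 * \<xi>) * exp (- r / (4 * \<xi>))
      \<le> 1 / (2 * \<xi>) * ((2 * \<xi> powr (1 / 4) * r powr (- 1 / 4)) * exp (- r / (8 * T)))"
    using assms by (intro mult_left_mono) auto
  also have "\<dots> = (\<xi> powr (1 / 4) / \<xi> powr 1) * decay T r"
    using assms by (simp add: decay_def)
  also have "\<dots> = \<xi> powr (1 / 4 - 1) * decay T r"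
    by (simp only: powr_diff)
  finally show ?thesis .
qed

text \<open>With \<open>z = x powr (1 / 4)\<close> the binomial expansion gives
  \<open>1 + z ^ 4 \<le> (1 + z) ^ 4\<close>. At \<open>x = 4 * T / r\<close> this turns the
  logarithmic singularity allowed for \<open>g\<close> into the power of \<open>r\<close> in
  \<open>decay\<close>.\<close>

lemma ln_one_plus_le_powr:
  fixes x :: real
  assumes "0 < x"
  shows "ln (1 + x) \<le> 4 * x powr (1 / 4)"
proof -
  define z where "z = x powr (1 / 4)"
  have z: "0 < z" using assms by (simp add: z_def)
  have "z ^ 4 = x"
    using assms by (simp add: z_def powr_powr flip: powr_realpow)
  moreover have "1 + z ^ 4 \<le> (1 + z) ^ 4"
    using z by (simp add: power4_eq_xxxx algebra_simps add_nonneg_nonneg)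
  ultimately have "ln (1 + x) \<le> ln ((1 + z) ^ 4)"
    using assms z by (subst ln_le_cancel_iff) auto
  also have "\<dots> = 4 * ln (1 + z)" using z by (simp add: ln_realpow)
  also have "\<dots> \<le> 4 * z" using ln_add_one_self_le_self[of z] z by simp
  finally show ?thesis by (simp add: z_def)
qed

lemma Linf_space_bound:
  assumes "f \<in> Linf_space M"
  obtains C where "0 \<le> C" "AE x in M. \<bar>f x\<bar> \<le> C"
proof -
  have ae: "AE x in M. ereal \<bar>f x\<bar> \<le> Linf_norm M f"
    unfolding Linf_norm_def by (rule esssup_AE)
  have "Linf_norm M f < \<infinity>" using assms by (simp add: Linf_space_def)
  then have "\<exists>C. Linf_norm M f \<le> ereal C"
    by (cases "Linf_norm M f") auto
  then obtain C where C: "Linf_norm M f \<le> ereal C" by blast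
  \<comment> \<open>The maximum covers null spaces, where the essential supremum is minus
    infinity.\<close>
  have "AE x in M. \<bar>f x\<bar> \<le> max 0 C"
    using ae
  proof eventually_elim
    case (elim x)
    then have "ereal \<bar>f x\<bar> \<le> ereal C" using C by (rule order_trans)
    then show ?case by simp
  qed
  then show ?thesis using that[of "max 0 C"] by simp
qed

lemma decay_bound_of_Linf:
  assumes T: "T > 0"
    and g: "(\<lambda>r. exp (r / (4 * T)) * g r / ln (1 + 4 * T / r)) \<in> Linf_space halfline"
  obtains K where "0 \<le> K" "AE r in halfline. \<bar>g r\<bar> \<le> K * decay T r"
proof -
  obtain C where C: "0 \<le> C" "AE r in halfline. \<bar>exp (r / (4 * T)) * g r / ln (1 + 4 * T / r)\<bar> \<le> C"
    using Linf_space_bound[OF g] by blast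
  have "AE r in halfline. \<bar>g r\<bar> \<le> C * (4 * (4 * T) powr (1 / 4)) * decay T r"
    using C(2) lebesgue_on_ae_space
  proof eventually_elim
    case (elim r)
    then have r: "0 < r" by simp
    define l where "l = ln (1 + 4 * T / r)"
    have l: "0 < l" using r T by (simp add: l_def add_pos_pos)
    have "exp (r / (4 * T)) * \<bar>g r\<bar> \<le> C * l"
      using elim(1) l by (simp add: l_def abs_mult field_simps)
    then have "\<bar>g r\<bar> \<le> C * l * exp (- r / (4 * T))"
      by (simp add: exp_minus field_simps)
    \<comment> \<open>Half of the exponential rate is discarded to match
      \<open>decay\<close>.\<close>
    also have "\<dots> \<le> C * (4 * (4 * T / r) powr (1 / 4)) * exp (- r / (8 * T))"
      unfolding l_def using T r C(1)
      by (intro mult_mono mult_left_mono ln_one_plus_le_powr) (auto simp: field_simps add_pos_pos)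
    also have "\<dots> = C * (4 * (4 * T) powr (1 / 4)) * decay T r"
      using T r by (simp add: decay_def powr_divide powr_minus field_simps)
    finally show ?case .
  qed
  moreover have "0 \<le> C * (4 * (4 * T) powr (1 / 4))" using C(1) by simp
  ultimately show ?thesis using that by blast
qed

section \<open>Admissible controls and time reversal\<close>

definition controls :: "real \<Rightarrow> real \<Rightarrow> (real \<Rightarrow> real) set" where
  "controls T L = {w \<in> borel_measurable (time_interval T). AE \<xi> in time_interval T. \<bar>w \<xi>\<bar> \<le> L}"

lemma controls_iff_Linf:
  "w \<in> controls T L \<longleftrightarrow> w \<in> Linf_space (time_interval T) \<and> Linf_norm (time_interval T) w \<le> ereal L"
proof
  assume w: "w \<in> controls T L"
  then have [measurable]: "w \<in> borel_measurable (time_interval T)" by (simp add: controls_def)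
  have "Linf_norm (time_interval T) w \<le> ereal L"
    unfolding Linf_norm_def using w by (intro esssup_I) (auto simp: controls_def)
  moreover from this have "Linf_norm (time_interval T) w < \<infinity>"
    by (rule order_le_less_trans) simp
  ultimately show "w \<in> Linf_space (time_interval T) \<and> Linf_norm (time_interval T) w \<le> ereal L"
    by (simp add: Linf_space_def)
next
  assume w: "w \<in> Linf_space (time_interval T) \<and> Linf_norm (time_interval T) w \<le> ereal L"
  have "AE \<xi> in time_interval T. ereal \<bar>w \<xi>\<bar> \<le> Linf_norm (time_interval T) w"
    unfolding Linf_norm_def by (rule esssup_AE)
  then have "AE \<xi> in time_interval T. \<bar>w \<xi>\<bar> \<le> L"
  proof eventually_elim
    case (elim \<xi>)
    then have "ereal \<bar>w \<xi>\<bar> \<le> ereal L" using w order_trans by blast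
    then show ?case by simp
  qed
  then show "w \<in> controls T L" using w by (simp add: controls_def Linf_space_def)
qed

text \<open>Reflection preserves Lebesgue measure and the interval. The reversal
  \<open>u (T - \<xi>)\<close> can thus be absorbed into the argument of \<open>response\<close>,
  and all estimates concern arbitrary controls.\<close>

lemma controls_reflect:
  assumes u: "u \<in> controls T L"
  shows "(\<lambda>\<xi>. u (T - \<xi>)) \<in> controls T L"
proof -
  have refl: "(\<lambda>\<xi>. T - \<xi>) \<in> lebesgue \<rightarrow>\<^sub>M lebesgue"
    using lebesgue_affine_measurable[of "\<lambda>_. - 1 :: real" T] by simp
  have "(\<lambda>\<xi>. T - \<xi>) \<in> time_interval T \<rightarrow>\<^sub>M time_interval T"
    by (intro measurable_restrict_space2 measurable_restrict_space1 refl) (auto simp: space_restrict_space)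
  then have "(\<lambda>\<xi>. u (T - \<xi>)) \<in> borel_measurable (time_interval T)"
    using u by (auto simp: controls_def intro: measurable_compose)
  moreover have "AE \<xi> in time_interval T. \<bar>u (T - \<xi>)\<bar> \<le> L"
  proof -
    \<comment> \<open>As an implication on the whole line, the bound can be transported by the
      reflection invariance of Lebesgue measure.\<close>
    have "AE \<xi> in lebesgue. \<xi> \<in> {0<..<T} \<longrightarrow> \<bar>u \<xi>\<bar> \<le> L"
      using u by (simp add: controls_def AE_restrict_space_iff)
    moreover have "distr lebesgue lebesgue (\<lambda>\<xi>. T - \<xi>) = lebesgue"
      using lebesgue_real_affine[of "- 1" T] by (simp add: density_1)
    ultimately have "AE \<xi> in distr lebesgue lebesgue (\<lambda>\<xi>. T - \<xi>). \<xi> \<in> {0<..<T} \<longrightarrow> \<bar>u \<xi>\<bar> \<le> L"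
      by metis
    from AE_distrD[OF refl this] show ?thesis
      by (auto simp: AE_restrict_space_iff elim: eventually_mono)
  qed
  ultimately show ?thesis by (simp add: controls_def)
qed

section \<open>Bounds and moments of the response\<close>

definition response :: "real \<Rightarrow> (real \<Rightarrow> real) \<Rightarrow> real \<Rightarrow> real" where
  "response T w r = - (1 / pi) * (\<integral>\<xi>. 1 / (2 * \<xi>) * exp (- r / (4 * \<xi>)) * w \<xi> \<partial>time_interval T)"

text \<open>This is the Gamma integrand at exponent 1/4 without its exponential, which is at least
  \<open>exp (- T)\<close> on the interval and so costs a factor \<open>exp T\<close>.\<close>

lemma singular_integrable: "integrable (time_interval T) (\<lambda>\<xi>. \<xi> powr (1 / 4 - 1))"
proof -
  have "integrable halfline (\<lambda>\<xi>. \<xi> powr (1 / 4 - 1) * exp (- 1 * \<xi>))"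
    by (rule integrable_power_exp_halfline) auto
  then have "integrable (time_interval T) (\<lambda>\<xi>. \<xi> powr (1 / 4 - 1) * exp (- 1 * \<xi>))"
    by (rule integrable_lebesgue_on_subset) auto
  then have "integrable (time_interval T) (\<lambda>\<xi>. exp T * (\<xi> powr (1 / 4 - 1) * exp (- 1 * \<xi>)))"
    by simp
  then show ?thesis
  proof (rule Bochner_Integration.integrable_bound)
    show "(\<lambda>\<xi>. \<xi> powr (1 / 4 - 1)) \<in> borel_measurable (time_interval T)"
      using id_measurable_lebesgue_on[of "{0<..<T}"] by measurable
    show "AE \<xi> in time_interval T. norm (\<xi> powr (1 / 4 - 1)) \<le> norm (exp T * (\<xi> powr (1 / 4 - 1) * exp (- 1 * \<xi>)))"
      using lebesgue_on_ae_space
    proof eventually_elim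
      case (elim \<xi>)
      have "\<xi> powr (1 / 4 - 1) * 1 \<le> \<xi> powr (1 / 4 - 1) * exp (T - \<xi>)"
        using elim by (intro mult_left_mono) auto
      then show ?case by (simp add: exp_diff exp_minus field_simps abs_mult)
    qed
  qed
qed

lemma kernel_control_bound:
  assumes w: "w \<in> controls T L" and r: "0 < r"
  shows "AE \<xi> in time_interval T. \<bar>1 / (2 * \<xi>) * exp (- r / (4 * \<xi>)) * w \<xi>\<bar>
           \<le> L * decay T r * \<xi> powr (1 / 4 - 1)"
proof -
  have "AE \<xi> in time_interval T. \<bar>w \<xi>\<bar> \<le> L" using w by (simp add: controls_def)
  then show ?thesis
    using lebesgue_on_ae_space
  proof eventually_elim
    case (elim \<xi>)
    have "(1 / (2 * \<xi>) * exp (- r / (4 * \<xi>))) * \<bar>w \<xi>\<bar> \<le> (\<xi> powr (1 / 4 - 1) * decay T r) * L"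
      using elim r by (intro mult_mono kernel_le_decay) (auto simp: decay_nonneg)
    then show ?case using elim by (simp add: abs_mult mult_ac)
  qed
qed

lemma kernel_control_integrable:
  assumes w: "w \<in> controls T L" and r: "0 < r"
  shows "integrable (time_interval T) (\<lambda>\<xi>. 1 / (2 * \<xi>) * exp (- r / (4 * \<xi>)) * w \<xi>)"
proof (rule Bochner_Integration.integrable_bound)
  show "integrable (time_interval T) (\<lambda>\<xi>. L * decay T r * \<xi> powr (1 / 4 - 1))"
    using singular_integrable by simp
  have [measurable]: "w \<in> borel_measurable (time_interval T)"
    "(\<lambda>x. x) \<in> borel_measurable (time_interval T)"
    using w by (simp_all add: controls_def id_measurable_lebesgue_on)
  show "(\<lambda>\<xi>. 1 / (2 * \<xi>) * exp (- r / (4 * \<xi>)) * w \<xi>) \<in> borel_measurable (time_interval T)"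
    by measurable
  show "AE \<xi> in time_interval T. norm (1 / (2 * \<xi>) * exp (- r / (4 * \<xi>)) * w \<xi>)
      \<le> norm (L * decay T r * \<xi> powr (1 / 4 - 1))"
    using kernel_control_bound[OF w r] by eventually_elim auto
qed

lemma response_measurable:
  assumes w: "w \<in> controls T L"
  shows "response T w \<in> borel_measurable halfline"
proof -
  interpret sigma_finite_measure "time_interval T"
    by (rule sigma_finite_lebesgue_on) simp
  have [measurable]: "w \<in> borel_measurable (time_interval T)"
    "(\<lambda>x. x) \<in> borel_measurable (time_interval T)" "(\<lambda>x. x) \<in> borel_measurable halfline"
    using w by (simp_all add: controls_def id_measurable_lebesgue_on)
  have [measurable]: "fst \<in> borel_measurable (halfline \<Otimes>\<^sub>M time_interval T)"
    "snd \<in> borel_measurable (halfline \<Otimes>\<^sub>M time_interval T)"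
    using measurable_compose[OF measurable_fst id_measurable_lebesgue_on]
      measurable_compose[OF measurable_snd id_measurable_lebesgue_on] by simp_all
  show ?thesis
    unfolding response_def[abs_def] by measurable
qed

lemma response_bound:
  assumes w: "w \<in> controls T L" and r: "0 < r"
  shows "\<bar>response T w r\<bar> \<le> (1 / pi * L * (\<integral>\<xi>. \<xi> powr (1 / 4 - 1) \<partial>time_interval T)) * decay T r"
proof -
  have "\<bar>\<integral>\<xi>. 1 / (2 * \<xi>) * exp (- r / (4 * \<xi>)) * w \<xi> \<partial>time_interval T\<bar>
      \<le> (\<integral>\<xi>. \<bar>1 / (2 * \<xi>) * exp (- r / (4 * \<xi>)) * w \<xi>\<bar> \<partial>time_interval T)"
    by (rule integral_abs_bound)
  also have "\<dots> \<le> (\<integral>\<xi>. L * decay T r * \<xi> powr (1 / 4 - 1) \<partial>time_interval T)"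
    by (intro integral_mono_AE integrable_abs kernel_control_integrable[OF w r]
        integrable_mult_right singular_integrable kernel_control_bound[OF w r])
  also have "\<dots> = L * decay T r * (\<integral>\<xi>. \<xi> powr (1 / 4 - 1) \<partial>time_interval T)" by simp
  finally have "1 / pi * \<bar>\<integral>\<xi>. 1 / (2 * \<xi>) * exp (- r / (4 * \<xi>)) * w \<xi> \<partial>time_interval T\<bar>
      \<le> 1 / pi * (L * decay T r * (\<integral>\<xi>. \<xi> powr (1 / 4 - 1) \<partial>time_interval T))"
    by (intro mult_left_mono) auto
  then show ?thesis by (simp add: response_def abs_mult mult_ac)
qed

text \<open>The constant does not depend on \<open>w\<close>; this uniformity gives the whole
  sequence of responses a single majorant.\<close>

lemma response_decay:
  assumes "L > 0"
  shows "\<exists>K\<ge>0. \<forall>w\<in>controls T L. AE r in halfline. \<bar>response T w r\<bar> \<le> K * decay T r"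
proof (intro exI conjI ballI)
  let ?K = "1 / pi * L * (\<integral>\<xi>. \<xi> powr (1 / 4 - 1) \<partial>time_interval T)"
  show "0 \<le> ?K" using assms by (intro mult_nonneg_nonneg Bochner_Integration.integral_nonneg) auto
  show "AE r in halfline. \<bar>response T w r\<bar> \<le> ?K * decay T r" if "w \<in> controls T L" for w
    by (rule AE_I2) (use response_bound[OF that] in \<open>auto simp: space_restrict_space\<close>)
qed

text \<open>For fixed \<open>\<xi>\<close> the integral of
  \<open>r ^ n * exp (- r / (4 * \<xi>))\<close> is \<open>fact n * (4 * \<xi>) ^ Suc n\<close>, and
  the factor \<open>1 / (2 * \<xi>)\<close> leaves
  \<open>2 ^ (2 * n + 1) * fact n * \<xi> ^ n\<close>. This is the origin of the constants in
  \<open>moment_coeff\<close>.\<close>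

lemma response_moment:
  assumes w: "w \<in> controls T L"
  shows "(\<integral>r. r ^ n * response T w r \<partial>halfline)
           = - (2 ^ (2 * n + 1) * fact n / pi) * (\<integral>\<xi>. \<xi> ^ n * w \<xi> \<partial>time_interval T)"
proof -
  interpret T: sigma_finite_measure "time_interval T"
    by (rule sigma_finite_lebesgue_on) simp
  interpret R: sigma_finite_measure halfline
    by (rule sigma_finite_lebesgue_on) simp
  interpret F: finite_measure "time_interval T"
    by (rule finite_measure_time_interval)
  interpret pair_sigma_finite "time_interval T" halfline ..
  have [measurable]: "w \<in> borel_measurable (time_interval T)"
    "(\<lambda>x. x) \<in> borel_measurable (time_interval T)" "(\<lambda>x. x) \<in> borel_measurable halfline"
    using w by (simp_all add: controls_def id_measurable_lebesgue_on)
  have [measurable]: "fst \<in> borel_measurable (time_interval T \<Otimes>\<^sub>M halfline)"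
    "snd \<in> borel_measurable (time_interval T \<Otimes>\<^sub>M halfline)"
    using measurable_compose[OF measurable_fst id_measurable_lebesgue_on]
      measurable_compose[OF measurable_snd id_measurable_lebesgue_on] by simp_all
  define f where "f \<xi> r = r ^ n * (1 / (2 * \<xi>) * exp (- r / (4 * \<xi>)) * w \<xi>)" for \<xi> r
  have [measurable]: "case_prod f \<in> borel_measurable (time_interval T \<Otimes>\<^sub>M halfline)"
    unfolding f_def[abs_def] by measurable
  have four: "(2 :: real) ^ (2 * n + 1) = 2 * 4 ^ n"
    by (simp add: power_mult)
  have f_int: "has_bochner_integral halfline (\<lambda>r. f \<xi> r) (2 ^ (2 * n + 1) * fact n * \<xi> ^ n * w \<xi>)"
    and f_abs: "has_bochner_integral halfline (\<lambda>r. \<bar>f \<xi> r\<bar>) (2 ^ (2 * n + 1) * fact n * \<xi> ^ n * \<bar>w \<xi>\<bar>)"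
    if \<xi>: "0 < \<xi>" for \<xi>
  proof -
    have "has_bochner_integral halfline (\<lambda>r. r ^ n * exp (- (1 / (4 * \<xi>)) * r)) (fact n / (1 / (4 * \<xi>)) ^ Suc n)"
      using \<xi> by (intro has_bochner_integral_power_exp_halfline) auto
    from has_bochner_integral_mult_right[OF this]
    have *: "has_bochner_integral halfline (\<lambda>r. c / (2 * \<xi>) * (r ^ n * exp (- (1 / (4 * \<xi>)) * r)))
        (c / (2 * \<xi>) * (fact n / (1 / (4 * \<xi>)) ^ Suc n))" for c by blast
    have c: "c / (2 * \<xi>) * (fact n / (1 / (4 * \<xi>)) ^ Suc n) = 2 ^ (2 * n + 1) * fact n * \<xi> ^ n * c" for c
      using \<xi> four by (simp add: field_simps power_mult_distrib)
    show "has_bochner_integral halfline (\<lambda>r. f \<xi> r) (2 ^ (2 * n + 1) * fact n * \<xi> ^ n * w \<xi>)"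
      using *[of "w \<xi>"] unfolding c by (simp add: f_def[abs_def] mult_ac)
    show "has_bochner_integral halfline (\<lambda>r. \<bar>f \<xi> r\<bar>) (2 ^ (2 * n + 1) * fact n * \<xi> ^ n * \<bar>w \<xi>\<bar>)"
    proof (rule has_bochner_integral_cong[THEN iffD1, OF refl _ refl])
      show "has_bochner_integral halfline (\<lambda>r. \<bar>w \<xi>\<bar> / (2 * \<xi>) * (r ^ n * exp (- (1 / (4 * \<xi>)) * r)))
          (2 ^ (2 * n + 1) * fact n * \<xi> ^ n * \<bar>w \<xi>\<bar>)"
        using *[of "\<bar>w \<xi>\<bar>"] unfolding c .
    qed (use \<xi> in \<open>auto simp: f_def abs_mult space_restrict_space\<close>)
  qed
  have "integrable (time_interval T \<Otimes>\<^sub>M halfline) (case_prod f)"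
  proof (rule Fubini_integrable)
    \<comment> \<open>Integration in \<open>r\<close> has cancelled the singularity
      \<open>1 / \<xi>\<close>, so an essential bound on a finite measure space suffices.\<close>
    have "integrable (time_interval T) (\<lambda>\<xi>. 2 ^ (2 * n + 1) * fact n * \<xi> ^ n * \<bar>w \<xi>\<bar>)"
    proof (rule F.integrable_const_bound[where B = "2 ^ (2 * n + 1) * fact n * T ^ n * L"])
      have "AE \<xi> in time_interval T. \<bar>w \<xi>\<bar> \<le> L" using w by (simp add: controls_def)
      then show "AE \<xi> in time_interval T. norm (2 ^ (2 * n + 1) * fact n * \<xi> ^ n * \<bar>w \<xi>\<bar>)
          \<le> 2 ^ (2 * n + 1) * fact n * T ^ n * L"
        using lebesgue_on_ae_space
      proof eventually_elim
        case (elim \<xi>)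
        have "2 ^ (2 * n + 1) * fact n * \<xi> ^ n * \<bar>w \<xi>\<bar> \<le> 2 ^ (2 * n + 1) * fact n * T ^ n * L"
          using elim by (intro mult_mono mult_left_mono power_mono) auto
        then show ?case using elim by (simp add: abs_mult)
      qed
    qed measurable
    also have "?this \<longleftrightarrow> integrable (time_interval T) (\<lambda>\<xi>. \<integral>r. norm (case_prod f (\<xi>, r)) \<partial>halfline)"
      by (intro Bochner_Integration.integrable_cong refl)
        (auto simp: space_restrict_space has_bochner_integral_integral_eq[OF f_abs])
    finally show "integrable (time_interval T) (\<lambda>\<xi>. \<integral>r. norm (case_prod f (\<xi>, r)) \<partial>halfline)" .
    show "AE \<xi> in time_interval T. integrable halfline (\<lambda>r. case_prod f (\<xi>, r))"
      using lebesgue_on_ae_space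
      by eventually_elim (auto intro: integrable.intros[OF f_int])
  qed measurable
  then have swap: "(\<integral>r. (\<integral>\<xi>. f \<xi> r \<partial>time_interval T) \<partial>halfline) = (\<integral>\<xi>. (\<integral>r. f \<xi> r \<partial>halfline) \<partial>time_interval T)"
    by (rule Fubini_integral)
  have "(\<integral>r. r ^ n * response T w r \<partial>halfline) = (\<integral>r. - (1 / pi) * (\<integral>\<xi>. f \<xi> r \<partial>time_interval T) \<partial>halfline)"
    by (simp only: response_def f_def integral_mult_right_zero mult.left_commute)
  also have "\<dots> = - (1 / pi) * (\<integral>r. (\<integral>\<xi>. f \<xi> r \<partial>time_interval T) \<partial>halfline)" by simp
  also have "\<dots> = - (1 / pi) * (\<integral>\<xi>. 2 ^ (2 * n + 1) * fact n * (\<xi> ^ n * w \<xi>) \<partial>time_interval T)"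
    unfolding swap
    by (intro arg_cong[where f = "\<lambda>x. - (1 / pi) * x"] Bochner_Integration.integral_cong refl)
      (auto simp: space_restrict_space has_bochner_integral_integral_eq[OF f_int])
  also have "\<dots> = - (2 ^ (2 * n + 1) * fact n / pi) * (\<integral>\<xi>. \<xi> ^ n * w \<xi> \<partial>time_interval T)"
    by simp
  finally show ?thesis .
qed

lemma response_in_L2_space:
  assumes "w \<in> controls T L" "L > 0" "T > 0"
  shows "response T w \<in> L2_space halfline"
proof -
  obtain K where K: "\<forall>w\<in>controls T L. AE r in halfline. \<bar>response T w r\<bar> \<le> K * decay T r"
    using response_decay[OF assms(2), of T] by (elim exE conjE) (rule that)
  have "(\<lambda>r. K * decay T r) \<in> L2_space halfline"
    using L2_space_lincomb[OF decay_L2_space[OF assms(3)] decay_L2_space[OF assms(3)], of K 0] by simp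
  then show ?thesis
    by (rule L2_space_dominated[OF response_measurable[OF assms(1)] _ K[rule_format, OF assms(1)]])
qed

section \<open>Convexity of the reachable set\<close>

lemma reachable_set_iff:
  "Y \<in> reachable_set T L \<longleftrightarrow> Y \<in> L2_space halfline \<and>
     (\<exists>u\<in>controls T L. AE r in halfline. Y r = response T (\<lambda>\<xi>. u (T - \<xi>)) r)"
  unfolding reachable_set_def response_def by (auto simp: controls_iff_Linf)

lemma reachable_set_convex:
  assumes X: "X \<in> reachable_set T L" and Y: "Y \<in> reachable_set T L" and t: "0 \<le> t" "t \<le> 1"
  shows "(\<lambda>r. (1 - t) * X r + t * Y r) \<in> reachable_set T L"
proof -
  obtain u v where u: "u \<in> controls T L" "AE r in halfline. X r = response T (\<lambda>\<xi>. u (T - \<xi>)) r"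
    and v: "v \<in> controls T L" "AE r in halfline. Y r = response T (\<lambda>\<xi>. v (T - \<xi>)) r"
    using X Y by (auto simp: reachable_set_iff)
  define z where "z \<xi> = (1 - t) * u \<xi> + t * v \<xi>" for \<xi>
  have "AE \<xi> in time_interval T. \<bar>u \<xi>\<bar> \<le> L" "AE \<xi> in time_interval T. \<bar>v \<xi>\<bar> \<le> L"
    using u v by (simp_all add: controls_def)
  then have "AE \<xi> in time_interval T. \<bar>z \<xi>\<bar> \<le> L"
  proof eventually_elim
    case (elim \<xi>)
    have "\<bar>z \<xi>\<bar> \<le> (1 - t) * \<bar>u \<xi>\<bar> + t * \<bar>v \<xi>\<bar>"
      unfolding z_def using t by (intro order_trans[OF abs_triangle_ineq]) (simp add: abs_mult)
    also have "\<dots> \<le> (1 - t) * L + t * L"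
      using elim t by (intro add_mono mult_left_mono) auto
    finally show ?case by (simp add: algebra_simps)
  qed
  moreover have "z \<in> borel_measurable (time_interval T)"
    using u v by (auto simp: controls_def z_def[abs_def])
  ultimately have z: "z \<in> controls T L"
    by (simp add: controls_def)
  have "AE r in halfline. (1 - t) * X r + t * Y r = response T (\<lambda>\<xi>. z (T - \<xi>)) r"
    using u(2) v(2) lebesgue_on_ae_space
  proof eventually_elim
    case (elim r)
    define k where "k \<xi> = 1 / (2 * \<xi>) * exp (- r / (4 * \<xi>))" for \<xi>
    have r: "0 < r" using elim by simp
    have i: "integrable (time_interval T) (\<lambda>\<xi>. k \<xi> * u (T - \<xi>))"
        "integrable (time_interval T) (\<lambda>\<xi>. k \<xi> * v (T - \<xi>))"
      unfolding k_def
      by (rule kernel_control_integrable[OF controls_reflect[OF u(1)] r]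
          kernel_control_integrable[OF controls_reflect[OF v(1)] r])+
    have "(\<integral>\<xi>. k \<xi> * z (T - \<xi>) \<partial>time_interval T)
        = (\<integral>\<xi>. (1 - t) * (k \<xi> * u (T - \<xi>)) + t * (k \<xi> * v (T - \<xi>)) \<partial>time_interval T)"
      by (intro Bochner_Integration.integral_cong refl) (simp add: z_def algebra_simps)
    also have "\<dots> = (1 - t) * (\<integral>\<xi>. k \<xi> * u (T - \<xi>) \<partial>time_interval T)
        + t * (\<integral>\<xi>. k \<xi> * v (T - \<xi>) \<partial>time_interval T)"
      using i by simp
    finally have "response T (\<lambda>\<xi>. z (T - \<xi>)) r = (1 - t) * response T (\<lambda>\<xi>. u (T - \<xi>)) r
        + t * response T (\<lambda>\<xi>. v (T - \<xi>)) r"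
      by (simp only: response_def k_def[symmetric]) (simp only: algebra_simps)
    then show ?case using elim by simp
  qed
  moreover have "(\<lambda>r. (1 - t) * X r + t * Y r) \<in> L2_space halfline"
    using X Y by (intro L2_space_lincomb) (auto simp: reachable_set_iff)
  ultimately show ?thesis using z by (auto simp: reachable_set_iff)
qed

section \<open>Weak convergence on the half line and conclusion\<close>

lemma halfline_weakly_null:
  assumes T: "T > 0"
    and h: "\<And>N. h N \<in> borel_measurable halfline"
    and bound: "\<And>N. AE r in halfline. \<bar>h N r\<bar> \<le> K * decay T r"
    and moments: "\<And>n. (\<lambda>N. \<integral>r. r ^ n * h N r \<partial>halfline) \<longlonglongrightarrow> 0"
    and v: "v \<in> L2_space halfline"
  shows "(\<lambda>N. \<integral>r. v r * h N r \<partial>halfline) \<longlonglongrightarrow> 0"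
proof -
  \<comment> \<open>With \<open>a = 1 / (32 * T)\<close> the required factor
    \<open>exp (2 * a * r)\<close> uses up half of the rate \<open>1 / (8 * T)\<close> of
    \<open>decay\<close>.\<close>
  interpret vanishing_moments halfline h "\<lambda>r. K * decay T r" "1 / (32 * T)"
  proof
    show "(\<lambda>x. x) \<in> borel_measurable halfline" by (rule id_measurable_lebesgue_on)
    show "AE x in halfline. 0 \<le> x" using lebesgue_on_ae_space by eventually_elim auto
    show "(\<lambda>r. K * decay T r) \<in> borel_measurable halfline" using decay_measurable by simp
    have "integrable halfline (\<lambda>r. K * (exp (r / (16 * T)) * decay T r))"
      using exp_decay_integrable[OF T] by simp
    then show "integrable halfline (\<lambda>r. exp (2 * (1 / (32 * T)) * r) * (K * decay T r))"
      by (simp add: mult_ac)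
  qed (use T h bound moments in auto)
  have [measurable]: "v \<in> borel_measurable halfline" using v by (simp add: L2_space_def)
  \<comment> \<open>The density argument reaches Borel functions on the line, whereas
    \<open>v\<close> is merely Lebesgue measurable on the half line. It is therefore extended by
    zero and replaced by a Borel version.\<close>
  have v0: "(\<lambda>r. indicator {0<..} r * v r) \<in> borel_measurable lebesgue"
    using \<open>v \<in> borel_measurable halfline\<close> by (simp add: borel_measurable_restrict_space_iff)
  obtain v' where v': "v' \<in> borel_measurable borel"
      "AE r in lborel. indicator {0<..} r * v r = v' r"
    using completion_ex_borel_measurable_real[OF v0] by auto
  have eq: "AE r in halfline. v r = v' r"
    using AE_completion[OF v'(2)] by (auto simp: AE_restrict_space_iff elim: eventually_mono)
  have eq_mult: "AE r in halfline. v r * f r = v' r * f r" for f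
    using eq by eventually_elim simp
  have [measurable]: "v' \<in> borel_measurable halfline"
    by (rule borel_measurable_lift[OF v'(1)])
  note [measurable] = h decay_measurable
  have "(\<lambda>r. K * decay T r) \<in> L2_space halfline"
    using L2_space_lincomb[OF decay_L2_space[OF T] decay_L2_space[OF T], of K 0] by simp
  from L2_space_mult_integrable[OF v this]
  have "integrable halfline (\<lambda>r. v r * (K * decay T r))" .
  also have "?this \<longleftrightarrow> integrable halfline (\<lambda>r. v' r * (K * decay T r))"
    by (intro integrable_cong_AE eq_mult) measurable
  finally have "weakly_null v'" by (rule weakly_null_borel[OF v'(1)])
  moreover have "(\<integral>r. v' r * h N r \<partial>halfline) = (\<integral>r. v r * h N r \<partial>halfline)" for N
    by (intro integral_cong_AE eq_mult[THEN AE_symmetric]) measurable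
  ultimately show ?thesis by (simp add: weakly_null_def)
qed

theorem theorem4p6:
  fixes L T :: real and g :: "real \<Rightarrow> real"
  assumes "L > 0" and "T > 0"
    and "g \<in> L2_space halfline"
    and "(\<lambda>r. exp (r / (4 * T)) * g r / ln (1 + 4 * T / r)) \<in> Linf_space halfline"
    and "\<forall>N::nat. \<exists>u \<in> Linf_space (time_interval T).
           Linf_norm (time_interval T) u \<le> ereal L \<and>
           (\<forall>n\<le>N. (\<integral>\<xi>. \<xi> ^ n * u (T - \<xi>) \<partial>time_interval T) = moment_coeff g n)"
  shows "g \<in> L2_closure halfline (reachable_set T L)"
proof -
  have "\<forall>N. \<exists>u\<in>controls T L. \<forall>n\<le>N. (\<integral>\<xi>. \<xi> ^ n * u (T - \<xi>) \<partial>time_interval T) = moment_coeff g n"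
    using assms(5) by (auto simp: controls_iff_Linf Bex_def)
  then obtain u where u: "\<And>N. u N \<in> controls T L"
      "\<And>N n. n \<le> N \<Longrightarrow> (\<integral>\<xi>. \<xi> ^ n * u N (T - \<xi>) \<partial>time_interval T) = moment_coeff g n"
    by metis
  define Y where "Y N = response T (\<lambda>\<xi>. u N (T - \<xi>))" for N
  have w: "(\<lambda>\<xi>. u N (T - \<xi>)) \<in> controls T L" for N
    by (rule controls_reflect[OF u(1)])
  have Y_L2: "Y N \<in> L2_space halfline" for N
    unfolding Y_def by (rule response_in_L2_space[OF w assms(1,2)])
  obtain K1 where K1: "0 \<le> K1" "AE r in halfline. \<bar>g r\<bar> \<le> K1 * decay T r"
    by (rule decay_bound_of_Linf[OF assms(2,4)])
  obtain K2 where K2: "0 \<le> K2" "\<forall>w\<in>controls T L. AE r in halfline. \<bar>response T w r\<bar> \<le> K2 * decay T r"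
    using response_decay[OF assms(1), of T] by (elim exE conjE) (rule that)
  define K where "K = K1 + K2"
  define h where "h N r = g r - Y N r" for N r
  have h_L2: "h N \<in> L2_space halfline" for N
    unfolding h_def[abs_def] by (rule L2_space_diff[OF assms(3) Y_L2])
  have h_bound: "AE r in halfline. \<bar>h N r\<bar> \<le> K * decay T r" for N
    using K1(2) K2(2)[rule_format, OF w[of N]]
  proof eventually_elim
    case (elim r)
    then show ?case by (simp add: h_def Y_def K_def algebra_simps)
  qed
  have moment_zero: "(\<integral>r. r ^ n * h N r \<partial>halfline) = 0" if "n \<le> N" for n N
  proof -
    have "(\<integral>r. r ^ n * h N r \<partial>halfline) = (\<integral>r. r ^ n * g r \<partial>halfline) - (\<integral>r. r ^ n * Y N r \<partial>halfline)"
      using power_mult_integrable[OF assms(2) _ K1(2), of n]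
        power_mult_integrable[OF assms(2) response_measurable[OF w] K2(2)[rule_format, OF w], of n N] assms(3)
      by (simp add: h_def Y_def L2_space_def right_diff_distrib)
    \<comment> \<open>The factor from \<open>response_moment\<close> is the reciprocal of the one in
      \<open>moment_coeff\<close>, signs included.\<close>
    also have "(\<integral>r. r ^ n * Y N r \<partial>halfline) = - (2 ^ (2 * n + 1) * fact n / pi) * moment_coeff g n"
      unfolding Y_def response_moment[OF w] u(2)[OF that] ..
    also have "\<dots> = (\<integral>r. r ^ n * g r \<partial>halfline)"
      by (simp add: moment_coeff_def)
    finally show ?thesis by simp
  qed
  \<comment> \<open>For fixed \<open>n\<close> the moment vanishes as soon as
    \<open>N \<ge> n\<close>, so the sequence is eventually zero.\<close>
  have moments: "(\<lambda>N. \<integral>r. r ^ n * h N r \<partial>halfline) \<longlonglongrightarrow> 0" for n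
    by (rule tendsto_eventually) (use moment_zero in \<open>auto simp: eventually_sequentially\<close>)
  show ?thesis
  \<comment> \<open>\<open>B\<close> is the squared norm of the common majorant, hence independent
    of \<open>N\<close>.\<close>
  proof (rule L2_closure_of_weak_limit[where Y = Y and B = "\<integral>r. (K * decay T r)\<^sup>2 \<partial>halfline"])
    show "reachable_set T L \<subseteq> L2_space halfline" by (auto simp: reachable_set_def)
    show "Y N \<in> reachable_set T L" for N
      using Y_L2[of N] u(1)[of N] unfolding reachable_set_iff Y_def by (auto intro!: bexI[of _ "u N"])
    show "(\<integral>r. (g r - Y N r)\<^sup>2 \<partial>halfline) \<le> (\<integral>r. (K * decay T r)\<^sup>2 \<partial>halfline)" for N
    proof (rule integral_mono_AE)
      show "integrable halfline (\<lambda>r. (g r - Y N r)\<^sup>2)"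
        using h_L2[of N] by (simp add: L2_space_def h_def)
      show "integrable halfline (\<lambda>r. (K * decay T r)\<^sup>2)"
        using decay_L2_space[OF assms(2)] by (simp add: L2_space_def power_mult_distrib)
      show "AE r in halfline. (g r - Y N r)\<^sup>2 \<le> (K * decay T r)\<^sup>2"
        using h_bound[of N]
        by eventually_elim (auto simp: h_def intro!: abs_le_square_iff[THEN iffD1])
    qed
    show "(\<lambda>N. \<integral>r. v r * (g r - Y N r) \<partial>halfline) \<longlonglongrightarrow> 0" if "v \<in> L2_space halfline" for v
    proof -
      have "h N \<in> borel_measurable halfline" for N
        using h_L2[of N] by (simp add: L2_space_def)
      from halfline_weakly_null[OF assms(2) this h_bound moments that] show ?thesis
        by (simp add: h_def)
    qed
  qed (use assms(3) reachable_set_convex in auto)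
qed

end
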